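(* $\mathcal A_1=\mathcal B_1$.
   Context: Let $M=\mathbb R^3$ with coordinates $(x,y,z)$, $X_1=\frac{\partial}{\partial x}$, $X_2=\frac{\partial}{\partial y}+\frac{x^2}{2}\frac{\partial}{\partial z}$, $U_1=\{(u_1,u_2)\in\mathbb R^2: u_2\ge|u_1|\}$, $q_0=(0,0,0)$. The set $\mathcal A_1$ is the attainable set from $q_0$ for arbitrary nonnegative time (the causal future of $q_0$): the set of all endpoints $q(t_1)$, $t_1\ge0$, of Lipschitz curves $q:[0,t_1]\to M$ with $q(0)=q_0$ satisfying $\dot q(t)=u_1(t)X_1(q(t))+u_2(t)X_2(q(t))$ for a.e. $t$, for some bounded measurable control $u:[0,t_1]\to U_1$. The set $\mathcal B_1$ is $$\mathcal B_1=\Big\{(x,y,z)\in\mathbb R^3:\ |x|\le y,\ \ \tfrac{|x|^3}{6}\le z\le \tfrac{1}{24}\big(-3|x|^3+3x^2y+3|x|y^2+y^3\big)\Big\}.$$ *)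

theory Defs
  imports "HOL-Analysis.Analysis"
begin

text \<open>The manifold \<open>M\<close> is \<open>real \<times> real \<times> real\<close> with coordinates \<open>(x, y, z)\<close>. A vector field
  is given by its components in the frame of coordinate derivatives.\<close>

definition X1 :: "real \<times> real \<times> real \<Rightarrow> real \<times> real \<times> real" where
  "X1 = (\<lambda>(x, y, z). (1, 0, 0))"

definition X2 :: "real \<times> real \<times> real \<Rightarrow> real \<times> real \<times> real" where
  "X2 = (\<lambda>(x, y, z). (0, 1, x\<^sup>2 / 2))"

definition U1 :: "(real \<times> real) set" where
  "U1 = {(u1, u2). u2 \<ge> \<bar>u1\<bar>}"

definition q0 :: "real \<times> real \<times> real" where
  "q0 = (0, 0, 0)"

text \<open>Only the values of \<open>u\<close> and \<open>q\<close> on \<open>{0..t1}\<close> matter: the derivative is taken within that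
  interval, and measurability is Lebesgue measurability on it.\<close>

definition admissible_control :: "(real \<times> real) set \<Rightarrow> real \<Rightarrow> (real \<Rightarrow> real \<times> real) \<Rightarrow> bool" where
  "admissible_control U t1 u \<longleftrightarrow>
     u \<in> borel_measurable (lebesgue_on {0..t1}) \<and>
     bounded (u ` {0..t1}) \<and>
     u ` {0..t1} \<subseteq> U"

definition trajectory :: "real \<Rightarrow> (real \<Rightarrow> real \<times> real) \<Rightarrow> (real \<Rightarrow> real \<times> real \<times> real) \<Rightarrow> bool" where
  "trajectory t1 u q \<longleftrightarrow>
     (\<exists>L. L-lipschitz_on {0..t1} q) \<and>
     (AE t in lebesgue_on {0..t1}.
        (q has_vector_derivative (fst (u t) *\<^sub>R X1 (q t) + snd (u t) *\<^sub>R X2 (q t)))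
          (at t within {0..t1}))"

definition A1 :: "(real \<times> real \<times> real) set" where
  "A1 = {q t1 | t1 u q. t1 \<ge> 0 \<and> admissible_control U1 t1 u \<and> trajectory t1 u q \<and> q 0 = q0}"

definition B1 :: "(real \<times> real \<times> real) set" where
  "B1 = {(x, y, z). \<bar>x\<bar> \<le> y \<and> \<bar>x\<bar> ^ 3 / 6 \<le> z \<and>
           z \<le> 1 / 24 * (- 3 * \<bar>x\<bar> ^ 3 + 3 * x\<^sup>2 * y + 3 * \<bar>x\<bar> * y\<^sup>2 + y ^ 3)}"

end

theory Submission imports Defs begin

text \<open>Along a trajectory the coordinates satisfy \<open>x' = u1\<close>, \<open>y' = u2\<close>, \<open>z' = u2 x\<^sup>2 / 2\<close> with
  \<open>\<bar>u1\<bar> \<le> u2\<close>. Thus, up to reparametrisation by \<open>y\<close>, a trajectory is a 1-Lipschitz function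
  \<open>x\<close> of \<open>s \<in> [0, Y]\<close> with \<open>x 0 = 0\<close>, and \<open>z\<close> is the integral of \<open>x\<^sup>2 / 2\<close>.
  For a prescribed end value \<open>X\<close> the Lipschitz condition forces
  \<open>max 0 (\<bar>X\<bar> - Y + s) \<le> \<bar>x s\<bar> \<le> min s (\<bar>X\<bar> + Y - s)\<close>. Half the squares of the two
  envelopes have integrals \<open>\<bar>X\<bar>\<^sup>3 / 6\<close> and \<open>(2 p\<^sup>3 - \<bar>X\<bar>\<^sup>3) / 6\<close> with \<open>p = (\<bar>X\<bar> + Y) / 2\<close>; these are the bounds in \<open>B1\<close>.

  For the inclusion \<open>A1 \<subseteq> B1\<close> no reparametrisation is carried out. Instead, a handful of
  polynomials in the coordinates are monotone in time, because their derivatives along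
  the flow have a sign: \<open>y \<plusminus> x\<close> and \<open>z \<plusminus> x\<^sup>3 / 6\<close> give the cone condition and the lower bound;
  \<open>y\<^sup>3 / 6 - z\<close>, used up to a time where \<open>y = p\<close>, and \<open>(\<bar>X\<bar> + Y - y)\<^sup>3 / 6 + z\<close>, used from
  then on, give the upper bound. As derivatives exist only almost everywhere, monotonicity rests on
  \<open>lipschitz_ae_nonneg_derivative_imp_mono_on\<close>.

  For the inclusion \<open>B1 \<subseteq> A1\<close> both envelopes are themselves admissible, and so are
  their convex combinations. The value of \<open>z\<close> is a continuous function of the parameter of
  the combination, so that it takes every value between the two extremes.\<close>

section \<open>Monotonicity from almost everywhere derivatives\<close>

text \<open>If \<open>g\<close> decreased, it would take every value \<open>c\<close> strictly between \<open>g b\<close> and \<open>g a\<close>. After the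
  last time at which it does so, \<open>g\<close> stays below \<open>c\<close>, so that its derivative at that time is not
  positive. This is a contradiction if \<open>c\<close> lies outside the image of the exceptional set. Such a
  \<open>c\<close> exists because Lipschitz functions map negligible sets to negligible sets.\<close>

lemma lipschitz_ae_pos_derivative_imp_le:
  fixes g :: "real \<Rightarrow> real"
  assumes lip: "L-lipschitz_on {a..b} g" and N: "negligible N" and ab: "a \<le> b"
    and der: "\<And>t. t \<in> {a..b} - N \<Longrightarrow> \<exists>D>0. (g has_real_derivative D) (at t within {a..b})"
  shows "g a \<le> g b"
proof (rule ccontr)
  assume "\<not> g a \<le> g b"
  then have less: "g b < g a" by simp
  have "negligible (g ` (N \<inter> {a..b}))"
  proof (rule negligible_locally_Lipschitz_image)
    show "negligible (N \<inter> {a..b})" using N negligible_Int by blast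
    show "\<exists>T B. open T \<and> x \<in> T \<and>
        (\<forall>y \<in> (N \<inter> {a..b}) \<inter> T. norm (g y - g x) \<le> B * norm (y - x))"
      if "x \<in> N \<inter> {a..b}" for x
      using that lipschitz_on_normD[OF lip] by (intro exI[of _ UNIV] exI[of _ L]) auto
  qed simp
  moreover have "\<not> negligible {g b<..<g a}"
    using less open_not_negligible[of "{g b<..<g a}"] by auto
  ultimately obtain c where c: "g b < c" "c < g a" "c \<notin> g ` (N \<inter> {a..b})"
    by (metis greaterThanLessThan_iff negligible_subset subsetI)
  define S where "S = {t \<in> {a..b}. g t = c}"
  have cont: "continuous_on {a..b} g"
    using lip lipschitz_on_continuous_on by blast
  have attains: "\<exists>t\<ge>s. t \<le> b \<and> g t = c" if "s \<in> {a..b}" "g s \<ge> c" for s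
    using IVT2'[of g b c s] that c continuous_on_subset[OF cont, of "{s..b}"] by auto
  have S_eq: "S = {a..b} \<inter> g -` {c}" by (auto simp: S_def)
  have "closed S" unfolding S_eq by (rule continuous_closed_preimage[OF cont]) auto
  moreover have "bounded S" by (rule bounded_subset[OF bounded_closed_interval]) (auto simp: S_def)
  ultimately have "compact S" by (simp add: compact_eq_bounded_closed)
  have "S \<noteq> {}" using attains[of a] c ab by (auto simp: S_def)
  obtain m where m: "m \<in> S" "\<And>t. t \<in> S \<Longrightarrow> t \<le> m"
    using compact_attains_sup[OF \<open>compact S\<close> \<open>S \<noteq> {}\<close>] by metis
  then have mS: "m \<in> {a..b}" "g m = c" by (auto simp: S_def)
  have "m \<noteq> b" using mS c by auto
  with mS have "m < b" by simp
  have below: "g t < c" if "m < t" "t \<le> b" for t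
  proof (rule ccontr)
    assume "\<not> g t < c"
    moreover have "t \<in> {a..b}" using that mS by auto
    ultimately obtain t' where "t' \<ge> t" "t' \<le> b" "g t' = c" using attains[of t] by auto
    with m(2)[of t'] that mS show False by (simp add: S_def)
  qed
  obtain D where D: "D > 0" "(g has_real_derivative D) (at m within {a..b})"
    using der[of m] mS c(3) by blast
  obtain d where d: "d > 0" "\<And>h. h > 0 \<Longrightarrow> m + h \<in> {a..b} \<Longrightarrow> h < d \<Longrightarrow> g m < g (m + h)"
    using has_real_derivative_pos_inc_right[OF D(2,1)] by blast
  define h where "h = min (d / 2) (b - m)"
  have h: "h > 0" "h < d" "m + h \<le> b" using \<open>m < b\<close> d(1) by (auto simp: h_def)
  have "g m < g (m + h)" using d(2)[OF h(1) _ h(2)] h mS by auto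
  with below[of "m + h"] h mS show False by simp
qed

text \<open>Adding \<open>e t\<close> with small \<open>e > 0\<close> makes a nonnegative derivative positive.\<close>

lemma lipschitz_ae_nonneg_derivative_imp_mono_on:
  fixes f :: "real \<Rightarrow> real"
  assumes lip: "L-lipschitz_on {a..b} f" and N: "negligible N"
    and der: "\<And>t. t \<in> {a..b} - N \<Longrightarrow> \<exists>D\<ge>0. (f has_real_derivative D) (at t within {a..b})"
  shows "mono_on {a..b} f"
proof (rule mono_onI)
  fix r s assume rs: "r \<in> {a..b}" "s \<in> {a..b}" "r \<le> s"
  then have sub: "{r..s} \<subseteq> {a..b}" by auto
  have approx: "f r + e * r \<le> f s + e * s" if e: "e > 0" for e
  proof (rule lipschitz_ae_pos_derivative_imp_le[where g = "\<lambda>t. f t + e * t", OF _ N \<open>r \<le> s\<close>])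
    show "(L + e)-lipschitz_on {r..s} (\<lambda>t. f t + e * t)"
      using e lipschitz_on_subset[OF lip sub] lipschitz_on_cmult_real_nonneg[OF lipschitz_on_id, of e "{r..s}"]
      by (intro lipschitz_on_add) auto
    fix t assume t: "t \<in> {r..s} - N"
    then obtain D where D: "D \<ge> 0" "(f has_real_derivative D) (at t within {a..b})"
      using der[of t] sub by blast
    have "((\<lambda>t. f t + e * t) has_real_derivative D + e) (at t within {r..s})"
      using DERIV_subset[OF D(2) sub] by (auto intro!: derivative_eq_intros)
    then show "\<exists>D>0. ((\<lambda>t. f t + e * t) has_real_derivative D) (at t within {r..s})"
      using D(1) e by (intro exI[of _ "D + e"]) auto
  qed
  show "f r \<le> f s"
  proof (rule field_le_epsilon)
    fix e :: real assume e: "e > 0"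
    define k where "k = e / (s - r + 1)"
    have "k > 0" using e rs by (simp add: k_def)
    have "k * (s - r) \<le> e" using e rs by (simp add: k_def field_simps)
    with approx[OF \<open>k > 0\<close>] show "f r \<le> f s + e" by (simp add: algebra_simps)
  qed
qed

text \<open>This makes polynomials in the coordinates of a trajectory Lipschitz, as the monotonicity
  criterion requires. Compactness provides the bounds on the factors.\<close>

lemma lipschitz_on_mult_compact:
  fixes f g :: "'a::metric_space \<Rightarrow> real"
  assumes "compact S" and f: "\<exists>L. L-lipschitz_on S f" and g: "\<exists>L. L-lipschitz_on S g"
  shows "\<exists>L. L-lipschitz_on S (\<lambda>t. f t * g t)"
proof -
  obtain K M where K: "K-lipschitz_on S f" and M: "M-lipschitz_on S g" using f g by blast
  have "bounded (f ` S)" "bounded (g ` S)"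
    using \<open>compact S\<close> K M lipschitz_on_continuous_on compact_continuous_image compact_imp_bounded
    by blast+
  then obtain A B where A: "A > 0" "\<And>t. t \<in> S \<Longrightarrow> \<bar>f t\<bar> \<le> A"
    and B: "B > 0" "\<And>t. t \<in> S \<Longrightarrow> \<bar>g t\<bar> \<le> B"
    unfolding bounded_pos by auto
  have "(A * M + K * B)-lipschitz_on S (\<lambda>t. f t * g t)"
  proof (rule lipschitz_onI)
    fix s t assume st: "s \<in> S" "t \<in> S"
    have "\<bar>f s * g s - f t * g t\<bar> = \<bar>f s * (g s - g t) + (f s - f t) * g t\<bar>"
      by (simp add: algebra_simps)
    also have "\<dots> \<le> \<bar>f s\<bar> * \<bar>g s - g t\<bar> + \<bar>f s - f t\<bar> * \<bar>g t\<bar>"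
      by (metis abs_mult abs_triangle_ineq)
    also have "\<dots> \<le> A * (M * dist s t) + (K * dist s t) * B"
      using A(2)[OF st(1)] B(2)[OF st(2)] lipschitz_onD[OF K st] lipschitz_onD[OF M st]
        lipschitz_on_nonneg[OF K] A(1)
      by (intro add_mono mult_mono) (auto simp: dist_real_def)
    finally show "dist (f s * g s) (f t * g t) \<le> (A * M + K * B) * dist s t"
      by (simp add: dist_real_def algebra_simps)
  next
    show "0 \<le> A * M + K * B"
      using A(1) B(1) lipschitz_on_nonneg[OF K] lipschitz_on_nonneg[OF M] by simp
  qed
  then show ?thesis by blast
qed

section \<open>Attainable points satisfy the bounds\<close>

lemma trajectory_coordinates:
  assumes "admissible_control U1 T u" and "trajectory T u q"
  obtains N where "negligible N"
    and "\<And>t. t \<in> {0..T} \<Longrightarrow> \<bar>fst (u t)\<bar> \<le> snd (u t)"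
    and "\<And>t. t \<in> {0..T} - N \<Longrightarrow>
      ((\<lambda>t. fst (q t)) has_real_derivative fst (u t)) (at t within {0..T})"
    and "\<And>t. t \<in> {0..T} - N \<Longrightarrow>
      ((\<lambda>t. fst (snd (q t))) has_real_derivative snd (u t)) (at t within {0..T})"
    and "\<And>t. t \<in> {0..T} - N \<Longrightarrow>
      ((\<lambda>t. snd (snd (q t))) has_real_derivative snd (u t) * (fst (q t))\<^sup>2 / 2) (at t within {0..T})"
    and "\<exists>L. L-lipschitz_on {0..T} (\<lambda>t. fst (q t))"
    and "\<exists>L. L-lipschitz_on {0..T} (\<lambda>t. fst (snd (q t)))"
    and "\<exists>L. L-lipschitz_on {0..T} (\<lambda>t. snd (snd (q t)))"
proof -
  let ?P = "\<lambda>t. (q has_vector_derivative (fst (u t) *\<^sub>R X1 (q t) + snd (u t) *\<^sub>R X2 (q t)))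
    (at t within {0..T})"
  define N where "N = {t \<in> {0..T}. \<not> ?P t}"
  have "AE t in lebesgue. t \<in> {0..T} \<longrightarrow> ?P t"
    using assms(2) unfolding trajectory_def by (subst (asm) AE_restrict_space_iff) auto
  then have "{t. \<not> (t \<in> {0..T} \<longrightarrow> ?P t)} \<in> null_sets lebesgue"
    by (simp add: completion.AE_iff_null_sets)
  moreover have "{t. \<not> (t \<in> {0..T} \<longrightarrow> ?P t)} = N" by (auto simp: N_def)
  ultimately have N: "negligible N" by (simp add: negligible_iff_null_sets)
  have u: "\<bar>fst (u t)\<bar> \<le> snd (u t)" if "t \<in> {0..T}" for t
    using assms(1) that by (fastforce simp: admissible_control_def U1_def)
  have d: "?P t" if "t \<in> {0..T} - N" for t using that by (auto simp: N_def)
  have field: "fst (u t) *\<^sub>R X1 (q t) + snd (u t) *\<^sub>R X2 (q t)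
      = (fst (u t), snd (u t), snd (u t) * (fst (q t))\<^sup>2 / 2)" for t
    by (cases "q t") (auto simp: X1_def X2_def)
  note bl = bounded_linear_fst bounded_linear_fst_comp[OF bounded_linear_snd]
    bounded_linear_snd_comp[OF bounded_linear_snd]
  have dd: "((\<lambda>t. fst (q t)) has_real_derivative fst (u t)) (at t within {0..T})"
      "((\<lambda>t. fst (snd (q t))) has_real_derivative snd (u t)) (at t within {0..T})"
      "((\<lambda>t. snd (snd (q t))) has_real_derivative snd (u t) * (fst (q t))\<^sup>2 / 2) (at t within {0..T})"
    if t: "t \<in> {0..T} - N" for t
    using bl[THEN bounded_linear.has_vector_derivative, OF d[OF t]]
    by (simp_all add: field has_real_derivative_iff_has_vector_derivative)
  obtain L where L: "L-lipschitz_on {0..T} q" using assms(2) by (auto simp: trajectory_def)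
  have lip: "\<exists>L. L-lipschitz_on {0..T} (\<lambda>t. f (q t))" if "bounded_linear f" for f :: "_ \<Rightarrow> real"
  proof -
    obtain B where "B-lipschitz_on (q ` {0..T}) f" using bounded_linear.lipschitz_boundE[OF \<open>bounded_linear f\<close>] by metis
    then show ?thesis using lipschitz_on_compose2[OF L, of B f] by blast
  qed
  show ?thesis
    by (rule that[OF N u dd lip[OF bl(1)] lip[OF bl(2)] lip[OF bl(3)]])
qed

lemma A1_subset_B1: "A1 \<subseteq> B1"
proof
  fix e assume "e \<in> A1"
  then obtain T u q where T: "T \<ge> 0" and e: "e = q T" and adm: "admissible_control U1 T u"
    and traj: "trajectory T u q" and q0: "q 0 = q0"
    unfolding A1_def by blast
  obtain x y z where q: "x = (\<lambda>t. fst (q t))" "y = (\<lambda>t. fst (snd (q t)))" "z = (\<lambda>t. snd (snd (q t)))"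
    by blast
  obtain N where N: "negligible N"
    and u: "\<And>t. t \<in> {0..T} \<Longrightarrow> \<bar>fst (u t)\<bar> \<le> snd (u t)"
    and dx: "\<And>t. t \<in> {0..T} - N \<Longrightarrow> (x has_real_derivative fst (u t)) (at t within {0..T})"
    and dy: "\<And>t. t \<in> {0..T} - N \<Longrightarrow> (y has_real_derivative snd (u t)) (at t within {0..T})"
    and dz: "\<And>t. t \<in> {0..T} - N \<Longrightarrow>
      (z has_real_derivative snd (u t) * (x t)\<^sup>2 / 2) (at t within {0..T})"
    and lx: "\<exists>L. L-lipschitz_on {0..T} x" and ly: "\<exists>L. L-lipschitz_on {0..T} y"
    and lz: "\<exists>L. L-lipschitz_on {0..T} z"
    using trajectory_coordinates[OF adm traj] unfolding q by blast
  have init: "x 0 = 0" "y 0 = 0" "z 0 = 0" using q0 by (auto simp: q q0_def)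
  have eq: "e = (x T, y T, z T)" by (simp add: e q)
  have ends: "0 \<in> {0..T}" "T \<in> {0..T}" using T by auto
  have mono: "mono_on {0..T} f"
    if "\<exists>L. L-lipschitz_on {0..T} f"
      "\<And>t. t \<in> {0..T} - N \<Longrightarrow> \<exists>D\<ge>0. (f has_real_derivative D) (at t within {0..T})" for f
    using that lipschitz_ae_nonneg_derivative_imp_mono_on[OF _ N] by blast
  have lip_add: "\<exists>L. L-lipschitz_on {0..T} (\<lambda>t. f t + g t)"
    if "\<exists>L. L-lipschitz_on {0..T} f" "\<exists>L. L-lipschitz_on {0..T} g" for f g :: "real \<Rightarrow> real"
    using that lipschitz_on_add by blast
  have lip_cmult: "\<exists>L. L-lipschitz_on {0..T} (\<lambda>t. c * f t)"
    if "\<exists>L. L-lipschitz_on {0..T} f" for c and f :: "real \<Rightarrow> real"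
    using that lipschitz_on_cmult_real by blast
  have lip_cube: "\<exists>L. L-lipschitz_on {0..T} (\<lambda>t. f t ^ 3)"
    if "\<exists>L. L-lipschitz_on {0..T} f" for f :: "real \<Rightarrow> real"
    using lipschitz_on_mult_compact[OF compact_Icc that lipschitz_on_mult_compact[OF compact_Icc that that]]
    by (simp add: power3_eq_cube mult.assoc)
  have lip_const: "\<exists>L. L-lipschitz_on {0..T} (\<lambda>t. c)" for c :: real
    using lipschitz_on_constant by blast
  note lips = lx ly lz lip_add lip_cmult lip_cube lip_const

  \<comment> \<open>Comparing with both the start and the end of the curve yields the two upper envelopes of
    \<open>\<bar>x\<bar>\<close> in terms of \<open>y\<close>.\<close>
  have cone: "\<bar>x t - x s\<bar> \<le> y t - y s" if "s \<in> {0..T}" "t \<in> {0..T}" "s \<le> t" for s t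
  proof -
    have "mono_on {0..T} (\<lambda>t. y t + c * x t)" if c: "\<bar>c\<bar> = 1" for c
    proof (rule mono)
      fix t assume t: "t \<in> {0..T} - N"
      show "\<exists>D\<ge>0. ((\<lambda>t. y t + c * x t) has_real_derivative D) (at t within {0..T})"
        using u[of t] t c
        by (intro exI[of _ "snd (u t) + c * fst (u t)"])
          (auto intro!: derivative_eq_intros dx dy simp: abs_if split: if_splits)
    qed (intro lips)
    from mono_onD[OF this[of 1] that] mono_onD[OF this[of "-1"] that] show ?thesis by simp
  qed
  have xy: "\<bar>x t\<bar> \<le> y t" if "t \<in> {0..T}" for t
    using cone[OF ends(1) that] that init by simp
  define w where "w = \<bar>x T\<bar> + y T"
  have xw: "\<bar>x t\<bar> \<le> w - y t" if "t \<in> {0..T}" for t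
    using cone[OF that ends(2)] that unfolding w_def by simp

  have lower: "\<bar>x T\<bar> ^ 3 / 6 \<le> z T"
  proof -
    have "mono_on {0..T} (\<lambda>t. z t + c / 6 * x t ^ 3)" if c: "\<bar>c\<bar> = 1" for c
    proof (rule mono)
      fix t assume t: "t \<in> {0..T} - N"
      have "0 \<le> (snd (u t) + c * fst (u t)) * ((x t)\<^sup>2 / 2)"
        using u[of t] t c by (intro mult_nonneg_nonneg) (auto simp: abs_if split: if_splits)
      then show "\<exists>D\<ge>0. ((\<lambda>t. z t + c / 6 * x t ^ 3) has_real_derivative D) (at t within {0..T})"
        using t by (intro exI[of _ "(snd (u t) + c * fst (u t)) * ((x t)\<^sup>2 / 2)"] conjI)
          (auto intro!: derivative_eq_intros dx dz simp: algebra_simps power2_eq_square)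
    qed (intro lips)
    from mono_onD[OF this[of 1] ends T] mono_onD[OF this[of "-1"] ends T]
    show ?thesis by (simp add: init abs_if)
  qed

  have upper: "z T \<le> ((w / 2) ^ 3 * 2 - \<bar>x T\<bar> ^ 3) / 6"
  proof -
    have first: "mono_on {0..T} (\<lambda>t. 1/6 * y t ^ 3 + (-1) * z t)"
    proof (rule mono)
      fix t assume t: "t \<in> {0..T} - N"
      have "(x t)\<^sup>2 \<le> (y t)\<^sup>2" using xy[of t] t power_mono[of "\<bar>x t\<bar>" "y t" 2] by simp
      then have "0 \<le> snd (u t) * (((y t)\<^sup>2 - (x t)\<^sup>2) / 2)"
        using u[of t] t by (intro mult_nonneg_nonneg) auto
      then show "\<exists>D\<ge>0. ((\<lambda>t. 1/6 * y t ^ 3 + (-1) * z t) has_real_derivative D) (at t within {0..T})"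
        using t by (intro exI[of _ "snd (u t) * (((y t)\<^sup>2 - (x t)\<^sup>2) / 2)"] conjI)
          (auto intro!: derivative_eq_intros dy dz simp: field_simps power2_eq_square)
    qed (intro lips)
    have second: "mono_on {0..T} (\<lambda>t. (-1/6) * (w + (-1) * y t) ^ 3 + (-1) * z t)"
    proof (rule mono)
      fix t assume t: "t \<in> {0..T} - N"
      have "(x t)\<^sup>2 \<le> (w - y t)\<^sup>2" using xw[of t] t power_mono[of "\<bar>x t\<bar>" "w - y t" 2] by simp
      then have "0 \<le> snd (u t) * (((w - y t)\<^sup>2 - (x t)\<^sup>2) / 2)"
        using u[of t] t by (intro mult_nonneg_nonneg) auto
      then show "\<exists>D\<ge>0. ((\<lambda>t. (-1/6) * (w + (-1) * y t) ^ 3 + (-1) * z t) has_real_derivative D)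
          (at t within {0..T})"
        using t by (intro exI[of _ "snd (u t) * (((w - y t)\<^sup>2 - (x t)\<^sup>2) / 2)"] conjI)
          (auto intro!: derivative_eq_intros dy dz simp: field_simps power2_eq_square)
    qed (intro lips)
    \<comment> \<open>The two upper envelopes \<open>y\<close> and \<open>w - y\<close> of \<open>\<bar>x\<bar>\<close> cross where \<open>y = w / 2\<close>.\<close>
    have "0 \<le> w / 2" "w / 2 \<le> y T" using xy[OF ends(2)] by (auto simp: w_def)
    moreover have "continuous_on {0..T} y" using ly lipschitz_on_continuous_on by blast
    ultimately obtain m where m: "m \<in> {0..T}" "y m = w / 2"
      using IVT'[of y 0 "w / 2" T] init T by auto
    have "z m \<le> (w / 2) ^ 3 / 6"
      using mono_onD[OF first ends(1) m(1)] m init by simp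
    moreover have "z T + \<bar>x T\<bar> ^ 3 / 6 \<le> z m + (w / 2) ^ 3 / 6"
    proof -
      have "w + (-1) * y m = w / 2" "w + (-1) * y T = \<bar>x T\<bar>" using m(2) by (simp_all add: w_def)
      with mono_onD[OF second m(1) ends(2)] m(1) show ?thesis by (simp del: mult_minus1)
    qed
    ultimately show ?thesis by (simp add: field_simps)
  qed
  have "((w / 2) ^ 3 * 2 - \<bar>x T\<bar> ^ 3) / 6
      = 1 / 24 * (- 3 * \<bar>x T\<bar> ^ 3 + 3 * (x T)\<^sup>2 * y T + 3 * \<bar>x T\<bar> * (y T)\<^sup>2 + y T ^ 3)"
    unfolding w_def by (simp add: field_simps power3_eq_cube power2_eq_square abs_if)
  then show "e \<in> B1"
    using xy[OF ends(2)] lower upper by (simp add: eq B1_def)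
qed

section \<open>Points within the bounds are attainable\<close>

text \<open>With \<open>y\<close> as the time parameter the control is \<open>(v, 1)\<close>, and the equation for \<open>z\<close>
  becomes \<open>z' = w\<^sup>2 / 2\<close>, which can be integrated.\<close>

lemma graph_endpoint_in_A1:
  fixes w v :: "real \<Rightarrow> real"
  assumes Y: "Y \<ge> 0" and lip: "1-lipschitz_on {0..Y} w" and w0: "w 0 = 0"
    and v: "v \<in> borel_measurable borel" "\<And>s. \<bar>v s\<bar> \<le> 1"
    and S: "finite S" "\<And>s. s \<notin> S \<Longrightarrow> (w has_real_derivative v s) (at s)"
  shows "(w Y, Y, integral {0..Y} (\<lambda>s. (w s)\<^sup>2 / 2)) \<in> A1"
proof -
  define z where "z t = integral {0..t} (\<lambda>s. (w s)\<^sup>2 / 2)" for t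
  define q where "q t = (w t, t, z t)" for t
  define u where "u t = (v t, 1 :: real)" for t
  have cont: "continuous_on {0..Y} w" using lip lipschitz_on_continuous_on by blast
  have dz: "(z has_vector_derivative (w t)\<^sup>2 / 2) (at t within {0..Y})" if "t \<in> {0..Y}" for t
    unfolding z_def using that cont by (intro integral_has_vector_derivative continuous_intros) auto
  have "admissible_control U1 Y u"
    unfolding admissible_control_def
  proof (intro conjI)
    have "u \<in> borel_measurable borel"
      unfolding u_def borel_prod[symmetric] using v(1) by measurable
    then have "u \<in> borel_measurable lebesgue" by (simp add: measurable_completion)
    then show "u \<in> borel_measurable (lebesgue_on {0..Y})" by (rule measurable_restrict_space1)
    have "norm (u t) \<le> 2" for t
      using norm_Pair_le[of "v t" "1::real"] v(2)[of t] by (simp add: u_def)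
    then show "bounded (u ` {0..Y})" by (auto simp: bounded_iff)
    show "u ` {0..Y} \<subseteq> U1" using v(2) by (auto simp: u_def U1_def)
  qed
  moreover have "trajectory Y u q"
    unfolding trajectory_def
  proof
    have "bounded (w ` {0..Y})"
      using cont compact_continuous_image compact_imp_bounded by blast
    then obtain B where B: "B > 0" "\<And>t. t \<in> {0..Y} \<Longrightarrow> \<bar>w t\<bar> \<le> B"
      unfolding bounded_pos by auto
    have lip_z: "(B\<^sup>2 / 2)-lipschitz_on {0..Y} z"
    proof (rule bounded_derivative_imp_lipschitz[where f' = "\<lambda>t h. h *\<^sub>R ((w t)\<^sup>2 / 2)"])
      fix t assume t: "t \<in> {0..Y}"
      show "(z has_derivative (\<lambda>h. h *\<^sub>R ((w t)\<^sup>2 / 2))) (at t within {0..Y})"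
        using dz[OF t] by (simp add: has_vector_derivative_def)
      have "(w t)\<^sup>2 \<le> B\<^sup>2" using power_mono[OF B(2)[OF t], of 2] by simp
      then show "onorm (\<lambda>h. h *\<^sub>R ((w t)\<^sup>2 / 2)) \<le> B\<^sup>2 / 2"
        by (intro onorm_le) (simp add: abs_mult mult.commute mult_left_mono)
    qed auto
    show "\<exists>L. L-lipschitz_on {0..Y} q"
      unfolding q_def by (rule exI, rule lipschitz_on_Pair[OF lip lipschitz_on_Pair[OF lipschitz_on_id lip_z]])
    have d: "(q has_vector_derivative (fst (u t) *\<^sub>R X1 (q t) + snd (u t) *\<^sub>R X2 (q t)))
        (at t within {0..Y})" if "t \<in> {0..Y}" "t \<notin> S" for t
    proof -
      have "(w has_vector_derivative v t) (at t within {0..Y})"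
        using S(2)[OF that(2)] has_field_derivative_at_within
        by (blast intro: has_real_derivative_iff_has_vector_derivative[THEN iffD1])
      then have "(q has_vector_derivative (v t, 1, (w t)\<^sup>2 / 2)) (at t within {0..Y})"
        unfolding q_def using dz[OF that(1)]
        by (intro has_vector_derivative_Pair has_vector_derivative_id) auto
      then show ?thesis by (simp add: u_def X1_def X2_def q_def)
    qed
    have "S \<in> null_sets lebesgue"
      using S(1) negligible_finite negligible_iff_null_sets by blast
    then have "AE t in lebesgue. t \<notin> S" by (rule AE_not_in)
    then have "AE t in lebesgue_on {0..Y}. t \<notin> S"
      by (subst AE_restrict_space_iff) auto
    then show "AE t in lebesgue_on {0..Y}.
        (q has_vector_derivative (fst (u t) *\<^sub>R X1 (q t) + snd (u t) *\<^sub>R X2 (q t))) (at t within {0..Y})"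
      using AE_space[of "lebesgue_on {0..Y}"] by eventually_elim (use d in auto)
  qed
  moreover have "q 0 = q0" by (simp add: q_def q0_def w0 z_def)
  ultimately have "q Y \<in> A1" unfolding A1_def using Y by blast
  then show ?thesis by (simp add: q_def z_def)
qed

text \<open>The least and the greatest value of \<open>\<bar>x\<bar>\<close> at \<open>y = s\<close> on the way from the origin to
  \<open>x = X\<close>, \<open>y = Y\<close>.\<close>

definition lower_envelope :: "real \<Rightarrow> real \<Rightarrow> real \<Rightarrow> real" where
  "lower_envelope X Y s = max 0 (s - (Y - X))"

definition upper_envelope :: "real \<Rightarrow> real \<Rightarrow> real \<Rightarrow> real" where
  "upper_envelope X Y s = min s (X + Y - s)"

lemma continuous_on_envelopes [continuous_intros]:
  "continuous_on A (lower_envelope X Y)" "continuous_on A (upper_envelope X Y)"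
  unfolding lower_envelope_def upper_envelope_def by (intro continuous_intros)+

lemma has_integral_lower_envelope:
  assumes "0 \<le> X" "X \<le> Y"
  shows "((\<lambda>s. (lower_envelope X Y s)\<^sup>2 / 2) has_integral X ^ 3 / 6) {0..Y}"
proof -
  let ?f = "\<lambda>s. (lower_envelope X Y s)\<^sup>2 / 2"
  have "(?f has_integral 0) {0..Y - X}"
    by (rule has_integral_eq[of _ "\<lambda>_. 0"]) (auto simp: lower_envelope_def)
  moreover have "(?f has_integral (X ^ 3 / 6)) {Y - X..Y}"
  proof (rule has_integral_eq)
    have "((\<lambda>s. (s - (Y - X))\<^sup>2 / 2) has_integral (Y - (Y - X)) ^ 3 / 6 - (Y - X - (Y - X)) ^ 3 / 6)
        {Y - X..Y}"
      using assms by (intro fundamental_theorem_of_calculus)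
        (auto intro!: derivative_eq_intros simp: has_real_derivative_iff_has_vector_derivative[symmetric])
    then show "((\<lambda>s. (s - (Y - X))\<^sup>2 / 2) has_integral X ^ 3 / 6) {Y - X..Y}" by simp
  qed (auto simp: lower_envelope_def)
  ultimately show ?thesis
    using has_integral_combine[of 0 "Y - X" Y ?f 0 "X ^ 3 / 6"] assms by simp
qed

lemma has_integral_upper_envelope:
  assumes "0 \<le> X" "X \<le> Y"
  shows "((\<lambda>s. (upper_envelope X Y s)\<^sup>2 / 2) has_integral
    1 / 24 * (- 3 * X ^ 3 + 3 * X\<^sup>2 * Y + 3 * X * Y\<^sup>2 + Y ^ 3)) {0..Y}"
proof -
  let ?f = "\<lambda>s. (upper_envelope X Y s)\<^sup>2 / 2"
  define p where "p = (X + Y) / 2"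
  have left: "upper_envelope X Y s = s" if "s \<le> p" for s
    using that by (simp add: upper_envelope_def p_def)
  have right: "upper_envelope X Y s = X + Y - s" if "p \<le> s" for s
    using that by (simp add: upper_envelope_def p_def)
  have p: "0 \<le> p" "p \<le> Y" using assms by (auto simp: p_def)
  have "(?f has_integral (p ^ 3 / 6)) {0..p}"
  proof (rule has_integral_eq)
    have "((\<lambda>s. s\<^sup>2 / 2) has_integral p ^ 3 / 6 - 0 ^ 3 / 6) {0..p}"
      using p by (intro fundamental_theorem_of_calculus)
        (auto intro!: derivative_eq_intros simp: has_real_derivative_iff_has_vector_derivative[symmetric])
    then show "((\<lambda>s. s\<^sup>2 / 2) has_integral p ^ 3 / 6) {0..p}" by simp
  qed (simp add: left)
  moreover have "(?f has_integral (- (X ^ 3 / 6) + p ^ 3 / 6)) {p..Y}"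
  proof (rule has_integral_eq)
    have "((\<lambda>s. (X + Y - s)\<^sup>2 / 2) has_integral - ((X + Y - Y) ^ 3 / 6) - - ((X + Y - p) ^ 3 / 6)) {p..Y}"
      using p by (intro fundamental_theorem_of_calculus)
        (auto intro!: derivative_eq_intros simp: has_real_derivative_iff_has_vector_derivative[symmetric])
    moreover have "X + Y - p = p" by (simp add: p_def field_simps)
    ultimately show "((\<lambda>s. (X + Y - s)\<^sup>2 / 2) has_integral - (X ^ 3 / 6) + p ^ 3 / 6) {p..Y}" by simp
  qed (simp add: right)
  moreover have "p ^ 3 / 6 + (- (X ^ 3 / 6) + p ^ 3 / 6)
      = 1 / 24 * (- 3 * X ^ 3 + 3 * X\<^sup>2 * Y + 3 * X * Y\<^sup>2 + Y ^ 3)"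
    unfolding p_def by (simp add: field_simps power3_eq_cube power2_eq_square)
  ultimately show ?thesis
    using has_integral_combine[OF p, of ?f] by metis
qed

text \<open>A convex combination of the envelopes is admissible as an \<open>x\<close>-coordinate because the slopes
  of both lie in \<open>[-1, 1]\<close>. The sign \<open>\<sigma>\<close> covers end points with \<open>x < 0\<close>: reflecting \<open>x\<close>
  changes neither the slope bound nor \<open>z\<close>.\<close>

lemma envelope_combination_endpoint_in_A1:
  assumes X: "0 \<le> X" "X \<le> Y" and l: "0 \<le> l" "l \<le> 1" and sgn: "\<bar>\<sigma>\<bar> = 1"
  shows "(\<sigma> * X, Y, integral {0..Y} (\<lambda>s. ((1 - l) * lower_envelope X Y s + l * upper_envelope X Y s)\<^sup>2 / 2)) \<in> A1"
proof -
  define w where "w s = (1 - l) * lower_envelope X Y s + l * upper_envelope X Y s" for s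
  define v where "v s = \<sigma> * ((1 - l) * (if s < Y - X then 0 else 1) + l * (if s < (X + Y) / 2 then 1 else - 1))"
    for s :: real
  have sq: "\<sigma>\<^sup>2 = 1" using sgn by (metis power2_abs power_one)
  have "(\<sigma> * w Y, Y, integral {0..Y} (\<lambda>s. (\<sigma> * w s)\<^sup>2 / 2)) \<in> A1"
  proof (rule graph_endpoint_in_A1[where v = v and S = "{Y - X, (X + Y) / 2}"])
    show "1-lipschitz_on {0..Y} (\<lambda>s. \<sigma> * w s)"
    proof (rule lipschitz_onI)
      fix s t :: real
      have "\<bar>lower_envelope X Y s - lower_envelope X Y t\<bar> \<le> \<bar>s - t\<bar>"
        by (auto simp: lower_envelope_def)
      moreover have "\<bar>upper_envelope X Y s - upper_envelope X Y t\<bar> \<le> \<bar>s - t\<bar>"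
        by (auto simp: upper_envelope_def)
      ultimately have "\<bar>(1 - l) * (lower_envelope X Y s - lower_envelope X Y t)
          + l * (upper_envelope X Y s - upper_envelope X Y t)\<bar> \<le> \<bar>s - t\<bar>"
        using l by (intro order_trans[OF abs_triangle_ineq]) (simp add: abs_mult convex_bound_le)
      moreover have "\<bar>\<sigma> * w s - \<sigma> * w t\<bar> = \<bar>w s - w t\<bar>"
        using sgn by (metis abs_mult mult_1 right_diff_distrib)
      ultimately show "dist (\<sigma> * w s) (\<sigma> * w t) \<le> 1 * dist s t"
        by (simp add: dist_real_def w_def algebra_simps)
    qed simp
    show "v \<in> borel_measurable borel" unfolding v_def by measurable
    show "\<bar>v s\<bar> \<le> 1" for s
      using l sgn by (auto simp: v_def abs_mult)
    show "((\<lambda>s. \<sigma> * w s) has_real_derivative v s) (at s)" if "s \<notin> {Y - X, (X + Y) / 2}" for s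
    proof -
      have a: "(lower_envelope X Y has_real_derivative (if s < Y - X then 0 else 1)) (at s)"
      proof (cases "s < Y - X")
        case True
        have "(lower_envelope X Y has_real_derivative 0) (at s)"
          by (rule has_field_derivative_transform_within_open[of "\<lambda>_. 0" _ _ "{..<Y - X}"])
            (use True in \<open>auto simp: lower_envelope_def\<close>)
        with True show ?thesis by simp
      next
        case False
        have "(lower_envelope X Y has_real_derivative 1) (at s)"
          by (rule has_field_derivative_transform_within_open[of "\<lambda>s. s - (Y - X)" _ _ "{Y - X<..}"])
            (use False that in \<open>auto simp: lower_envelope_def intro!: derivative_eq_intros\<close>)
        with False show ?thesis by simp
      qed
      have b: "(upper_envelope X Y has_real_derivative (if s < (X + Y) / 2 then 1 else - 1)) (at s)"
      proof (cases "s < (X + Y) / 2")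
        case True
        have "(upper_envelope X Y has_real_derivative 1) (at s)"
          by (rule has_field_derivative_transform_within_open[of "\<lambda>s. s" _ _ "{..<(X + Y) / 2}"])
            (use True in \<open>auto simp: upper_envelope_def\<close>)
        with True show ?thesis by simp
      next
        case False
        have "(upper_envelope X Y has_real_derivative - 1) (at s)"
          by (rule has_field_derivative_transform_within_open[of "\<lambda>s. X + Y - s" _ _ "{(X + Y) / 2<..}"])
            (use False that in \<open>auto simp: upper_envelope_def min_def field_simps intro!: derivative_eq_intros\<close>)
        with False show ?thesis by simp
      qed
      show ?thesis
        unfolding w_def v_def
        by (rule DERIV_cmult[OF DERIV_add[OF DERIV_cmult[OF a] DERIV_cmult[OF b]]])
    qed
  qed (use X in \<open>auto simp: w_def lower_envelope_def upper_envelope_def\<close>)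
  moreover have "w Y = X" using X by (simp add: w_def lower_envelope_def upper_envelope_def algebra_simps)
  moreover have "(\<sigma> * w s)\<^sup>2 = (w s)\<^sup>2" for s by (simp add: power_mult_distrib sq)
  ultimately show ?thesis by (simp add: w_def)
qed

lemma B1_subset_A1: "B1 \<subseteq> A1"
proof
  fix e assume "e \<in> B1"
  then obtain x Y z where e: "e = (x, Y, z)" and xY: "\<bar>x\<bar> \<le> Y" and zl: "\<bar>x\<bar> ^ 3 / 6 \<le> z"
    and zu: "z \<le> 1 / 24 * (- 3 * \<bar>x\<bar> ^ 3 + 3 * x\<^sup>2 * Y + 3 * \<bar>x\<bar> * Y\<^sup>2 + Y ^ 3)"
    by (auto simp: B1_def)
  define X where "X = \<bar>x\<bar>"
  have X: "0 \<le> X" "X \<le> Y" using xY by (auto simp: X_def)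
  obtain \<sigma> where \<sigma>: "\<bar>\<sigma>\<bar> = 1" "x = \<sigma> * X"
    by (cases "x \<ge> 0") (auto simp: X_def intro: that[of 1] that[of "-1"])
  let ?a = "lower_envelope X Y" and ?b = "upper_envelope X Y"
  define J where "J l = integral {0..Y} (\<lambda>s. ((1 - l) * ?a s + l * ?b s)\<^sup>2 / 2)" for l
  have J0: "J 0 = X ^ 3 / 6" and J1: "J 1 = 1 / 24 * (- 3 * X ^ 3 + 3 * X\<^sup>2 * Y + 3 * X * Y\<^sup>2 + Y ^ 3)"
    using integral_unique[OF has_integral_lower_envelope[OF X]]
      integral_unique[OF has_integral_upper_envelope[OF X]]
    by (simp_all add: J_def)
  \<comment> \<open>\<open>J\<close> is continuous because the square expands to a quadratic polynomial in \<open>l\<close>.\<close>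
  define Q where "Q l = (1 - l)\<^sup>2 * (X ^ 3 / 6) + (1 - l) * l * integral {0..Y} (\<lambda>s. ?a s * ?b s)
    + l\<^sup>2 * (1 / 24 * (- 3 * X ^ 3 + 3 * X\<^sup>2 * Y + 3 * X * Y\<^sup>2 + Y ^ 3))" for l
  have J_eq_Q: "J l = Q l" for l
  proof -
    have "((\<lambda>s. (1 - l)\<^sup>2 * ((?a s)\<^sup>2 / 2) + (1 - l) * l * (?a s * ?b s) + l\<^sup>2 * ((?b s)\<^sup>2 / 2))
        has_integral Q l) {0..Y}"
      unfolding Q_def
      by (intro has_integral_add has_integral_mult_right has_integral_lower_envelope
          has_integral_upper_envelope X integrable_integral integrable_continuous_real continuous_intros)
    moreover have "(\<lambda>s. (1 - l)\<^sup>2 * ((?a s)\<^sup>2 / 2) + (1 - l) * l * (?a s * ?b s) + l\<^sup>2 * ((?b s)\<^sup>2 / 2))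
       = (\<lambda>s. ((1 - l) * ?a s + l * ?b s)\<^sup>2 / 2)"
      by (simp add: fun_eq_iff power2_sum power_mult_distrib add_divide_distrib)
    ultimately show ?thesis unfolding J_def by (simp only: integral_unique)
  qed
  have "continuous_on {0..1} Q" unfolding Q_def by (intro continuous_intros)
  then have "continuous_on {0..1} J" by (simp add: J_eq_Q cong: continuous_on_cong)
  then obtain l where l: "0 \<le> l" "l \<le> 1" "J l = z"
    using IVT'[of J 0 z 1] zl zu by (auto simp: J0 J1 X_def)
  show "e \<in> A1"
    using envelope_combination_endpoint_in_A1[OF X l(1,2) \<sigma>(1)] l(3) by (simp add: e \<sigma>(2) J_def)
qed

theorem theorem3: "A1 = B1"
  using A1_subset_B1 B1_subset_A1 by (rule subset_antisym)

end
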